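(* Let $\Delta \subset \mathbb{R}^n$ be a compact convex set containing the origin, and for $x \in \mathbb{R}^n$ let $T(x) = \operatorname{argmax}_{y \in \Delta} x \cdot y$ (a set). Let $\{x_i\}_{i \ge 0}$ be any sequence with $x_0 \in \Delta$ and $x_{i+1} \in T(x_i)$ for all $i \ge 0$. Then: (1) $\{x_i\}$ has at least one limit point; (2) if $\{x_i\}$ has more than one limit point, the set of its limit points is connected; (3) every limit point $x^*$ of $\{x_i\}$ is a fixed point of $T$, i.e. $x^* \in T(x^* )$.
   Context: Here $x\cdot y$ is the standard inner product on $\mathbb{R}^n$, and $T(x) = \{ y \in \Delta : x\cdot y \ge x \cdot z \ \text{for all } z \in \Delta\}$ is in general set valued; at each step of the iteration any element of $T(x_i)$ may be chosen as $x_{i+1}$. A limit point of a sequence is a limit of some convergent subsequence. A fixed point of $T$ is a point $x \in \Delta$ with $x \in T(x)$. *)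

theory Defs
  imports "HOL-Analysis.Analysis"
begin

definition argmax_inner :: "('a::real_inner) set \<Rightarrow> 'a \<Rightarrow> 'a set" where
  "argmax_inner \<Delta> x = {y \<in> \<Delta>. \<forall>z\<in>\<Delta>. x \<bullet> y \<ge> x \<bullet> z}"

text \<open>Subsequential limits of a sequence; these differ from the limit points
  (accumulation points, \<open>islimpt\<close>) of its range: a constant sequence has one.\<close>

definition seq_limit_points :: "(nat \<Rightarrow> 'a::topological_space) \<Rightarrow> 'a set" where
  "seq_limit_points x = {l. \<exists>r::nat \<Rightarrow> nat. strict_mono r \<and> (x \<circ> r) \<longlonglongrightarrow> l}"

definition is_fixed_point_on :: "'a set \<Rightarrow> ('a \<Rightarrow> 'a set) \<Rightarrow> 'a \<Rightarrow> bool" where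
  "is_fixed_point_on \<Delta> F x \<longleftrightarrow> x \<in> \<Delta> \<and> x \<in> F x"

end

theory Submission
  imports Defs
begin

text \<open>
  Since \<open>x i\<close> is itself a competitor in the maximization that defines \<open>x (Suc i)\<close>, the inner
  product of the two is at least \<open>(norm (x i))\<^sup>2\<close>. Expanding the square of a difference then gives
  \<open>(norm (x (Suc i) - x i))\<^sup>2 \<le> (norm (x (Suc i)))\<^sup>2 - (norm (x i))\<^sup>2\<close>. So the squared norms
  increase; they are bounded by compactness, hence convergent, and the steps
  \<open>x (Suc i) - x i\<close> tend to zero (\<open>argmax_iteration_steps_tendsto_zero\<close>).

  Everything else follows from vanishing steps. A subsequence converging to \<open>l\<close>, shifted by one
  index, still converges to \<open>l\<close>, so the maximality of \<open>x (Suc i)\<close> against \<open>x i\<close> passes to the limit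
  and says that \<open>l\<close> is a fixed point. A sequence in a compact set with vanishing steps cannot jump
  between two separated parts of its limit set without accumulating in the gap between them, so
  that set is connected (\<open>connected_seq_limit_points\<close>).
\<close>

lemma subseq_has_seq_limit_point:
  fixes x :: "nat \<Rightarrow> 'a::metric_space" and r :: "nat \<Rightarrow> nat"
  assumes "compact K" and "\<And>i. x i \<in> K" and "strict_mono r"
  obtains l s where "strict_mono s" "(x \<circ> (r \<circ> s)) \<longlonglongrightarrow> l" "l \<in> seq_limit_points x"
proof -
  have "seq_compact K"
    using assms(1) by (simp add: compact_imp_seq_compact)
  moreover have "\<forall>n. (x \<circ> r) n \<in> K"
    using assms(2) by simp
  ultimately obtain l s where "l \<in> K" and s: "strict_mono s" "((x \<circ> r) \<circ> s) \<longlonglongrightarrow> l"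
    by (rule seq_compactE)
  have lim: "(x \<circ> (r \<circ> s)) \<longlonglongrightarrow> l"
    using s(2) by (simp add: comp_assoc)
  moreover have "strict_mono (r \<circ> s)"
    using assms(3) s(1) by (rule strict_mono_o)
  ultimately have "l \<in> seq_limit_points x"
    unfolding seq_limit_points_def by blast
  with s(1) lim show thesis by (rule that)
qed

lemma tendsto_Suc_subseq_if_steps_vanish:
  fixes x :: "nat \<Rightarrow> 'a::metric_space"
  assumes steps: "(\<lambda>i. dist (x (Suc i)) (x i)) \<longlonglongrightarrow> 0"
    and r: "strict_mono r" and lim: "(x \<circ> r) \<longlonglongrightarrow> l"
  shows "(\<lambda>k. x (Suc (r k))) \<longlonglongrightarrow> l"
proof -
  have "(\<lambda>k. dist (x (Suc (r k))) (x (r k))) \<longlonglongrightarrow> 0"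
    using LIMSEQ_subseq_LIMSEQ[OF steps r] by (simp add: o_def)
  moreover have "(\<lambda>k. dist (x (r k)) l) \<longlonglongrightarrow> 0"
    using lim by (simp add: o_def tendsto_dist_iff[symmetric])
  ultimately have sum: "(\<lambda>k. dist (x (Suc (r k))) (x (r k)) + dist (x (r k)) l) \<longlonglongrightarrow> 0"
    using tendsto_add_zero by blast
  have "(\<lambda>k. dist (x (Suc (r k))) l) \<longlonglongrightarrow> 0"
    by (rule tendsto_sandwich[OF _ _ tendsto_const sum]) (simp_all add: dist_triangle)
  then show ?thesis
    by (simp add: tendsto_dist_iff[symmetric])
qed

lemma infinitely_often_positive_near_limit_point:
  fixes x :: "nat \<Rightarrow> 'a::topological_space" and f :: "'a \<Rightarrow> real"
  assumes "continuous_on UNIV f" and "l \<in> seq_limit_points x" and "0 < f l"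
  obtains i where "i \<ge> N" "0 < f (x i)"
proof -
  obtain r where r: "strict_mono r" "(x \<circ> r) \<longlonglongrightarrow> l"
    using assms(2) unfolding seq_limit_points_def by blast
  have "(\<lambda>k. f ((x \<circ> r) k)) \<longlonglongrightarrow> f l"
    using continuous_on_tendsto_compose[OF assms(1) r(2)] by simp
  then have "\<forall>\<^sub>F k in sequentially. 0 < f ((x \<circ> r) k)"
    using assms(3) by (rule order_tendstoD(1))
  then obtain M where M: "\<And>k. k \<ge> M \<Longrightarrow> 0 < f (x (r k))"
    unfolding eventually_sequentially by auto
  have "N \<le> r (max M N)"
    using seq_suble[OF r(1), of "max M N"] by linarith
  moreover have "0 < f (x (r (max M N)))"
    using M by simp
  ultimately show thesis by (rule that)
qed

text \<open>
  A discrete intermediate value argument: the sequence \<open>f (x i)\<close> crosses from negative to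
  nonnegative infinitely often. Along the crossing times, \<open>x i\<close> and \<open>x (Suc i)\<close> have a common limit
  point because the steps vanish, and there \<open>f\<close> is both nonpositive and nonnegative.
\<close>

lemma seq_limit_points_contain_zero:
  fixes x :: "nat \<Rightarrow> 'a::metric_space" and f :: "'a \<Rightarrow> real"
  assumes K: "compact K" "\<And>i. x i \<in> K"
    and steps: "(\<lambda>i. dist (x (Suc i)) (x i)) \<longlonglongrightarrow> 0"
    and cont: "continuous_on UNIV f"
    and a: "a \<in> seq_limit_points x" "f a < 0"
    and b: "b \<in> seq_limit_points x" "0 < f b"
  obtains l where "l \<in> seq_limit_points x" "f l = 0"
proof -
  define S where "S = {i. f (x i) < 0 \<and> 0 \<le> f (x (Suc i))}"
  have "\<exists>i\<ge>N. i \<in> S" for N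
  proof (rule ccontr)
    assume no_crossing: "\<not> (\<exists>i\<ge>N. i \<in> S)"
    obtain m where m: "m \<ge> N" "f (x m) < 0"
    proof -
      have "continuous_on UNIV (\<lambda>y. - f y)" "0 < - f a"
        using cont a(2) by (auto intro: continuous_on_minus)
      from infinitely_often_positive_near_limit_point[OF this(1) a(1) this(2), of N] that
      show thesis by auto
    qed
    have negative: "f (x j) < 0" if "j \<ge> m" for j
      using that
    proof (induction rule: dec_induct)
      case base
      show ?case by (rule m(2))
    next
      case (step j)
      then have "j \<notin> S"
        using no_crossing m(1) by auto
      with step.IH show ?case
        by (simp add: S_def)
    qed
    obtain j where "j \<ge> m" "0 < f (x j)"
      using infinitely_often_positive_near_limit_point[OF cont b] by blast
    with negative[of j] show False by simp
  qed
  then have inf: "infinite S"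
    by (simp add: infinite_nat_iff_unbounded_le)
  define r where "r = enumerate S"
  have r: "strict_mono r" "r k \<in> S" for k
    using inf unfolding r_def by (simp_all add: strict_mono_enumerate enumerate_in_set)
  obtain l s where s: "strict_mono s" "(x \<circ> (r \<circ> s)) \<longlonglongrightarrow> l" "l \<in> seq_limit_points x"
    by (rule subseq_has_seq_limit_point[OF K r(1)])
  have rs: "strict_mono (r \<circ> s)"
    using r(1) s(1) by (rule strict_mono_o)
  have "(\<lambda>k. f ((x \<circ> (r \<circ> s)) k)) \<longlonglongrightarrow> f l"
    using continuous_on_tendsto_compose[OF cont s(2)] by simp
  moreover have "f ((x \<circ> (r \<circ> s)) k) \<le> 0" for k
    using r(2)[of "s k"] by (simp add: S_def)
  ultimately have "f l \<le> 0"
    by (intro LIMSEQ_le_const2) auto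
  moreover have "(\<lambda>k. f (x (Suc ((r \<circ> s) k)))) \<longlonglongrightarrow> f l"
    using continuous_on_tendsto_compose[OF cont
        tendsto_Suc_subseq_if_steps_vanish[OF steps rs s(2)]] by simp
  moreover have "0 \<le> f (x (Suc ((r \<circ> s) k)))" for k
    using r(2)[of "s k"] by (simp add: S_def)
  ultimately have "f l = 0"
    by (intro antisym LIMSEQ_le_const) auto
  with s(3) show thesis by (rule that)
qed

text \<open>
  If open sets \<open>U\<close> and \<open>V\<close> disconnected the limit set, the difference of the distances to their
  complements would be a continuous function without zeros on the limit set that takes both signs
  there, contrary to the intermediate value property above.
\<close>

lemma connected_seq_limit_points:
  fixes x :: "nat \<Rightarrow> 'a::metric_space"
  assumes K: "compact K" "\<And>i. x i \<in> K"
    and steps: "(\<lambda>i. dist (x (Suc i)) (x i)) \<longlonglongrightarrow> 0"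
  shows "connected (seq_limit_points x)"
proof (rule connectedI)
  let ?L = "seq_limit_points x"
  fix U V :: "'a set"
  assume UV: "open U" "open V" "U \<inter> ?L \<noteq> {}" "V \<inter> ?L \<noteq> {}" "U \<inter> V \<inter> ?L = {}" "?L \<subseteq> U \<union> V"
  define f where "f y = infdist y (- V) - infdist y (- U)" for y
  have cont: "continuous_on UNIV f"
    unfolding f_def by (intro continuous_on_diff continuous_on_infdist continuous_on_id)
  \<comment> \<open>The complements must be nonempty because \<open>infdist y {}\<close> is \<open>0\<close>.\<close>
  have nonempty: "- U \<noteq> {}" "- V \<noteq> {}"
    using UV(3-5) by blast+
  have on_U: "f y < 0" if "y \<in> U" "y \<in> ?L" for y
  proof -
    have "y \<in> - V" "y \<notin> - U" using that UV(5) by auto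
    then have "infdist y (- V) = 0" "0 < infdist y (- U)"
      using nonempty UV(1) by (auto intro!: infdist_pos_not_in_closed)
    then show ?thesis by (simp add: f_def)
  qed
  have on_V: "0 < f y" if "y \<in> V" "y \<in> ?L" for y
  proof -
    have "y \<in> - U" "y \<notin> - V" using that UV(5) by auto
    then have "infdist y (- U) = 0" "0 < infdist y (- V)"
      using nonempty UV(2) by (auto intro!: infdist_pos_not_in_closed)
    then show ?thesis by (simp add: f_def)
  qed
  obtain a b where a: "a \<in> U" "a \<in> ?L" and b: "b \<in> V" "b \<in> ?L"
    using UV(3,4) by auto
  obtain l where "l \<in> ?L" "f l = 0"
    by (rule seq_limit_points_contain_zero[OF K steps cont a(2) on_U[OF a] b(2) on_V[OF b]])
  then show False
    using on_U[of l] on_V[of l] UV(6) by auto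
qed

lemma argmax_iteration_steps_tendsto_zero:
  fixes x :: "nat \<Rightarrow> 'a::real_inner"
  assumes "bounded \<Delta>" and mem: "\<And>i. x i \<in> \<Delta>"
    and iter: "\<And>i. x (Suc i) \<in> argmax_inner \<Delta> (x i)"
  shows "(\<lambda>i. dist (x (Suc i)) (x i)) \<longlonglongrightarrow> 0"
proof -
  define q where "q i = (norm (x i))\<^sup>2" for i
  have step: "(dist (x (Suc i)) (x i))\<^sup>2 \<le> q (Suc i) - q i" for i
  proof -
    have "x i \<bullet> x i \<le> x i \<bullet> x (Suc i)"
      using iter[of i] mem[of i] by (simp add: argmax_inner_def)
    then show ?thesis
      by (simp add: q_def dist_norm power2_norm_eq_inner inner_diff_left inner_diff_right
          inner_commute[of "x (Suc i)" "x i"])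
  qed
  obtain B where B: "\<And>y. y \<in> \<Delta> \<Longrightarrow> norm y \<le> B"
    using assms(1) unfolding bounded_iff by blast
  have "q i \<le> B\<^sup>2" for i
    unfolding q_def using B[OF mem] by (intro power_mono) auto
  moreover have "incseq q"
  proof (rule incseq_SucI)
    show "q i \<le> q (Suc i)" for i
      using step[of i] zero_le_power2[of "dist (x (Suc i)) (x i)"] by linarith
  qed
  ultimately obtain c where c: "q \<longlonglongrightarrow> c"
    using incseq_convergent[of q "B\<^sup>2"] by blast
  have diff: "(\<lambda>i. q (Suc i) - q i) \<longlonglongrightarrow> 0"
    using tendsto_diff[OF LIMSEQ_Suc[OF c] c] by simp
  have "(\<lambda>i. (dist (x (Suc i)) (x i))\<^sup>2) \<longlonglongrightarrow> 0"
    by (rule tendsto_sandwich[OF _ _ tendsto_const diff]) (simp_all add: step)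
  from tendsto_real_sqrt[OF this] show ?thesis
    by simp
qed

theorem theorem1:
  fixes \<Delta> :: "(real ^ 'n) set"
    and x :: "nat \<Rightarrow> real ^ 'n"
  assumes "compact \<Delta>"
    and "convex \<Delta>"
    and "0 \<in> \<Delta>"
    and "x 0 \<in> \<Delta>"
    and "\<And>i. x (Suc i) \<in> argmax_inner \<Delta> (x i)"
  shows "seq_limit_points x \<noteq> {}
    \<and> ((\<exists>a\<in>seq_limit_points x. \<exists>b\<in>seq_limit_points x. a \<noteq> b)
          \<longrightarrow> connected (seq_limit_points x))
    \<and> (\<forall>l\<in>seq_limit_points x. is_fixed_point_on \<Delta> (argmax_inner \<Delta>) l)"
proof -
  have mem: "x i \<in> \<Delta>" for i
    using assms(4,5) by (cases i) (auto simp: argmax_inner_def)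
  have steps: "(\<lambda>i. dist (x (Suc i)) (x i)) \<longlonglongrightarrow> 0"
    by (rule argmax_iteration_steps_tendsto_zero[where \<Delta> = \<Delta>])
      (use assms(5) mem in \<open>simp_all add: compact_imp_bounded[OF assms(1)]\<close>)
  have "seq_limit_points x \<noteq> {}"
    by (rule subseq_has_seq_limit_point[where x = x, OF assms(1) mem strict_mono_id]) auto
  moreover have "connected (seq_limit_points x)"
    by (rule connected_seq_limit_points[where x = x, OF assms(1) mem steps])
  moreover have "is_fixed_point_on \<Delta> (argmax_inner \<Delta>) l" if "l \<in> seq_limit_points x" for l
  proof -
    obtain r where r: "strict_mono r" "(x \<circ> r) \<longlonglongrightarrow> l"
      using \<open>l \<in> seq_limit_points x\<close> unfolding seq_limit_points_def by blast
    then have lim: "(\<lambda>k. x (r k)) \<longlonglongrightarrow> l"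
      by (simp add: o_def)
    have "l \<in> \<Delta>"
      using closed_sequentially[OF compact_imp_closed[OF assms(1)] _ lim] mem by blast
    moreover have "l \<bullet> z \<le> l \<bullet> l" if "z \<in> \<Delta>" for z
    proof (rule LIMSEQ_le)
      show "(\<lambda>k. x (r k) \<bullet> z) \<longlonglongrightarrow> l \<bullet> z"
        by (intro tendsto_intros lim)
      show "(\<lambda>k. x (r k) \<bullet> x (Suc (r k))) \<longlonglongrightarrow> l \<bullet> l"
        by (intro tendsto_inner lim tendsto_Suc_subseq_if_steps_vanish[OF steps r])
      show "\<exists>N. \<forall>k\<ge>N. x (r k) \<bullet> z \<le> x (r k) \<bullet> x (Suc (r k))"
        using assms(5) \<open>z \<in> \<Delta>\<close> by (simp add: argmax_inner_def)
    qed
    ultimately show ?thesis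
      by (simp add: is_fixed_point_on_def argmax_inner_def)
  qed
  ultimately show ?thesis by blast
qed

end
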